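(* Let $s$ be a positive integer and let $F:\mathbb{Z}_{\geq 0}^s\to\mathbb{Z}_{\geq 0}$ be monotonically increasing. For each $i\in\{1,\dots,s\}$ and each fixed choice of $x_1,\dots,x_{i-1},x_{i+1},\dots,x_s\in\mathbb{Z}_{\geq 0}$, let $g_{x_1,\dots,x_{i-1},x_{i+1},\dots,x_s}:\mathbb{Z}_{\geq 0}\to\mathbb{Z}_{\geq 0}$ be the one-variable function $g_{x_1,\dots,x_{i-1},x_{i+1},\dots,x_s}(x_i)=F(x_1,x_2,\dots,x_s)$. Suppose that for all $x_1,\dots,x_s,y\in\mathbb{Z}_{\geq 0}$ with $y\leq F(x_1,\dots,x_s)$, the Grundy number of the chocolate bar $CB(F,x_1,\dots,x_s,y)$ is $$\mathcal{G}(\{x_1,x_2,\dots,x_s,y\})=x_1\oplus x_2\oplus\cdots\oplus x_s\oplus y.$$ Then for every $i\in\{1,\dots,s\}$ and every fixed $x_1,\dots,x_{i-1},x_{i+1},\dots,x_s\in\mathbb{Z}_{\geq 0}$, the function $g_{x_1,\dots,x_{i-1},x_{i+1},\dots,x_s}$ has the NS property.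
   Context: $\oplus$ denotes nim-sum (bitwise XOR of nonnegative integers). Monotonicity: $F:\mathbb{Z}_{\geq 0}^s\to\mathbb{Z}_{\geq 0}$ is monotonically increasing if $F(x_1,\dots,x_s)\leq F(x_1',\dots,x_s')$ whenever $x_i\leq x_i'$ for all $i=1,\dots,s$. For $s=1$ this is the usual notion of a (weakly) monotonically increasing function. NS property: a monotonically increasing function $h:\mathbb{Z}_{\geq 0}\to\mathbb{Z}_{\geq 0}$ has the NS property if, for all $z,z'\in\mathbb{Z}_{\geq 0}$ and every integer $i\geq 1$, $\lfloor z/2^i\rfloor=\lfloor z'/2^i\rfloor$ implies $\lfloor h(z)/2^{i-1}\rfloor=\lfloor h(z')/2^{i-1}\rfloor$. Chocolate bar: for a fixed monotonically increasing $F$, the $(s+1)$-dimensional chocolate bar $CB(F,x_1,\dots,x_s,y)$ consists of unit boxes; for each $(u_1,\dots,u_s)$ with $0\leq u_i\leq x_i$, the column at position $(u_1,\dots,u_s)$ has length $\min(F(u_1,\dots,u_s),y)+1$ in the $(s+1)$-th direction. The box at the bottom of the column at $(0,\dots,0)$ is bitter. Players alternately cut the bar along a groove by a hyperplane perpendicular to one of the $s+1$ coordinate axes and eat the piece not containing the bitter box; the player who leaves the opponent with the single bitter box wins. The bar is represented by its coordinates $\{x_1,\dots,x_s,y\}$ (an ordered tuple), which count the grooves of the bar in each direction, so positions are tuples with $y\leq F(x_1,\dots,x_s)$. Moves: the set of positions reachable in one move from $\{x_1,\dots,x_s,y\}$ is $$move_F(\{x_1,\dots,x_s,y\})=\bigcup_{i=1}^{s}\big\{\{x_1,\dots,x_{i-1},u,x_{i+1},\dots,x_s,\min(F(x_1,\dots,x_{i-1},u,x_{i+1},\dots,x_s),y)\}:u\in\mathbb{Z}_{\geq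 0},\,u<x_i\big\}\cup\big\{\{x_1,\dots,x_s,w\}:w\in\mathbb{Z}_{\geq 0},\,w<y\big\}.$$ Grundy number: $\mathcal{G}(\mathbf{p})=\mathrm{mex}\{\mathcal{G}(\mathbf{q}):\mathbf{q}\in move_F(\mathbf{p})\}$, where $\mathrm{mex}(S)$ is the least nonnegative integer not in $S$. *)

theory Defs
  imports Main
begin

text \<open>
  A vector \<open>(x\<^sub>1, \<dots>, x\<^sub>s)\<close> is a list of length \<open>s\<close>, so coordinates are indexed from \<open>0\<close>.
  A function \<open>F\<close> of \<open>s\<close> variables is only ever constrained on lists of length \<open>s\<close>.
\<close>

definition nim_sum :: "nat list \<Rightarrow> nat" where
  "nim_sum xs = foldr xor xs 0"

definition monotonically_increasing :: "nat \<Rightarrow> (nat list \<Rightarrow> nat) \<Rightarrow> bool" where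
  "monotonically_increasing s F \<longleftrightarrow>
     (\<forall>xs xs'. length xs = s \<and> length xs' = s \<and> (\<forall>i<s. xs ! i \<le> xs' ! i) \<longrightarrow> F xs \<le> F xs')"

definition NS_property :: "(nat \<Rightarrow> nat) \<Rightarrow> bool" where
  "NS_property h \<longleftrightarrow> mono h \<and>
     (\<forall>z z' i. 1 \<le> i \<longrightarrow> z div 2 ^ i = z' div 2 ^ i \<longrightarrow> h z div 2 ^ (i - 1) = h z' div 2 ^ (i - 1))"

text \<open>
  The bar with coordinates \<open>{x\<^sub>1, \<dots>, x\<^sub>s, y}\<close> is the pair of the list of the \<open>x\<^sub>i\<close> and \<open>y\<close>.
  Positions satisfy \<open>y \<le> F xs\<close>, which every move preserves.
\<close>

type_synonym position = "nat list \<times> nat"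

definition move :: "(nat list \<Rightarrow> nat) \<Rightarrow> position \<Rightarrow> position set" where
  "move F = (\<lambda>(xs, y).
     (\<Union>i<length xs. {(xs[i := u], min (F (xs[i := u])) y) | u. u < xs ! i}) \<union>
     {(xs, w) | w. w < y})"

definition mex :: "nat set \<Rightarrow> nat" where
  "mex S = (LEAST n. n \<notin> S)"

lemma sum_list_update_less:
  fixes xs :: "nat list"
  assumes "i < length xs" "u < xs ! i"
  shows "sum_list (xs[i := u]) < sum_list xs"
  using assms by (induction xs arbitrary: i) (auto split: nat.splits)

lemma move_decreases:
  assumes "q \<in> move F p"
  shows "sum_list (fst q) + snd q < sum_list (fst p) + snd p"
  using assms
  by (cases p) (auto simp: move_def intro!: add_less_le_mono[OF sum_list_update_less])

function grundy :: "(nat list \<Rightarrow> nat) \<Rightarrow> position \<Rightarrow> nat" where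
  "grundy F p = mex (grundy F ` move F p)"
  by auto
termination
  by (relation "measure (\<lambda>(F, xs, y). sum_list xs + y)") (auto dest: move_decreases)

declare grundy.simps [simp del]

text \<open>
  The one-variable function obtained from \<open>F\<close> by fixing all coordinates except the \<open>i\<close>-th;
  the \<open>i\<close>-th entry of \<open>xs\<close> is overwritten and hence irrelevant.
\<close>

definition section_fun :: "(nat list \<Rightarrow> nat) \<Rightarrow> nat list \<Rightarrow> nat \<Rightarrow> nat \<Rightarrow> nat" where
  "section_fun F xs i = (\<lambda>z. F (xs[i := z]))"

end

theory Submission
  imports Defs
begin

unbundle bit_operations_syntax

text \<open>
  Fix all coordinates but one and let \<open>h\<close> be the section. Cutting the remaining coordinate from
  \<open>v\<close> to \<open>u\<close> in a bar with \<open>h u < y \<le> h v\<close> replaces \<open>y\<close> by \<open>h u\<close>, and the two Grundy numbers must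
  differ; the other coordinates cancel from the nim-sums, so \<open>v \<noteq> u \<oplus> h u \<oplus> y\<close>. This condition on
  \<open>h\<close> alone forces the NS property.

  Let \<open>m\<close> be minimal such that the property fails on \<open>{0, \<dots>, m}\<close>. Then some multiple \<open>Y\<close> of \<open>2 ^ j\<close>
  satisfies \<open>h (m - 1) < Y \<le> h m\<close>, where \<open>m - 1\<close> and \<open>m\<close> agree above bit \<open>j\<close>. Let \<open>b \<ge> j\<close> be the
  lowest bit of \<open>Y\<close>. If bit \<open>b\<close> of \<open>m\<close> is \<open>0\<close>, then \<open>v = (m - 1) \<oplus> h (m - 1) \<oplus> Y\<close> exceeds \<open>m\<close>, which
  violates the condition. If it is \<open>1\<close>, the NS property below \<open>m\<close> makes \<open>u \<mapsto> u \<oplus> h u\<close> onto modulo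
  \<open>2 ^ b\<close> on the dyadic block preceding that of \<open>m\<close>, so some \<open>u\<close> in it has \<open>u \<oplus> h u \<oplus> Y = m\<close>.
\<close>

lemma finite_move: "finite (move F p)"
proof -
  obtain xs y where p: "p = (xs, y)" by (cases p)
  have "move F p = (\<Union>i<length xs. (\<lambda>u. (xs[i := u], min (F (xs[i := u])) y)) ` {..<xs ! i})
      \<union> Pair xs ` {..<y}"
    by (auto simp: p move_def)
  then show ?thesis by simp
qed

lemma mex_notin:
  assumes "finite S"
  shows "mex S \<notin> S"
  unfolding mex_def using ex_new_if_finite[OF infinite_UNIV_nat assms] by (rule LeastI_ex)

lemma grundy_move_neq: "q \<in> move F p \<Longrightarrow> grundy F q \<noteq> grundy F p"
  by (metis finite_imageI finite_move grundy.simps image_eqI mex_notin)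

lemma nim_sum_append: "nim_sum (xs @ ys) = nim_sum xs XOR nim_sum ys"
  by (induction xs) (simp_all add: nim_sum_def xor.assoc)

text \<open>Splits off the coordinate being cut; the rest is common to both bars and
  cancels.\<close>

lemma nim_sum_update:
  "i < length xs \<Longrightarrow> nim_sum (xs[i := a]) = a XOR nim_sum (xs[i := 0])"
  by (induction xs arbitrary: i)
    (auto simp: nim_sum_def xor.left_commute split: nat.splits)

lemma mono_section_fun:
  assumes "monotonically_increasing s F" "length xs = s"
  shows "mono (section_fun F xs i)"
  using assms
  by (cases "i < length xs")
    (auto simp: mono_def section_fun_def monotonically_increasing_def nth_list_update)

lemma section_fun_neq:
  assumes grundy: "\<And>xs y. length xs = s \<Longrightarrow> y \<le> F xs \<Longrightarrow> grundy F (xs, y) = nim_sum (xs @ [y])"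
    and xs: "length xs = s" "i < s"
    and u: "u < v" "section_fun F xs i u < y" "y \<le> section_fun F xs i v"
  shows "v \<noteq> u XOR section_fun F xs i u XOR y"
proof
  let ?h = "section_fun F xs i"
  assume v: "v = u XOR ?h u XOR y"
  have "(xs[i := u], ?h u) \<in> move F (xs[i := v], y)"
    using xs u by (auto simp: move_def section_fun_def min_def intro!: bexI[of _ i] exI[of _ u])
  from grundy_move_neq[OF this]
  have "nim_sum (xs[i := u] @ [?h u]) \<noteq> nim_sum (xs[i := v] @ [y])"
    using grundy xs u by (simp add: section_fun_def)
  then have "u XOR nim_sum (xs[i := 0]) XOR ?h u \<noteq> v XOR nim_sum (xs[i := 0]) XOR y"
    using xs by (simp add: nim_sum_append nim_sum_update[of i xs u] nim_sum_update[of i xs v]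
        xor.assoc) (simp add: nim_sum_def)
  moreover have "v XOR nim_sum (xs[i := 0]) XOR y = u XOR nim_sum (xs[i := 0]) XOR ?h u"
    unfolding v by (rule bit_eqI) (auto simp: bit_xor_iff)
  ultimately show False by simp
qed

text \<open>Bounding the arguments permits induction on \<open>m\<close>; \<open>Suc j\<close>
  stands for the exponent \<open>i\<close>, so that no subtraction occurs.\<close>

definition NS_below :: "nat \<Rightarrow> (nat \<Rightarrow> nat) \<Rightarrow> bool" where
  "NS_below m h \<longleftrightarrow>
     (\<forall>z<m. \<forall>z'<m. \<forall>j. z div 2 ^ Suc j = z' div 2 ^ Suc j \<longrightarrow> h z div 2 ^ j = h z' div 2 ^ j)"

lemma NS_belowD:
  assumes "NS_below m h" "z < m" "z' < m" "z div 2 ^ Suc j = z' div 2 ^ Suc j"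
  shows "h z div 2 ^ j = h z' div 2 ^ j"
  using assms unfolding NS_below_def by blast

lemma div_power_Suc_two: "n div 2 ^ Suc b = n div 2 ^ b div (2::nat)"
  by (simp add: power_Suc2 div_mult2_eq del: power_Suc)

lemma NS_below_xor_onto:
  assumes "NS_below m h" "(a + 1) * 2 ^ b \<le> m"
  shows "\<exists>u. u div 2 ^ b = a \<and> take_bit b (u XOR h u) = take_bit b t"
  using assms(2)
proof (induction b arbitrary: a)
  case 0
  show ?case by simp
next
  case (Suc b)
  \<comment> \<open>Bit \<open>b\<close> of \<open>h\<close> is constant on the block, so it prescribes the half in which to look for \<open>u\<close>.\<close>
  define c where "c = 2 * a + of_bool (bit (h (a * 2 ^ Suc b)) b \<noteq> bit t b)"
  have "c + 1 \<le> 2 * (a + 1)" by (simp add: c_def)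
  then have "(c + 1) * 2 ^ b \<le> 2 * (a + 1) * 2 ^ b" by (rule mult_le_mono1)
  also have "\<dots> \<le> m" using Suc.prems by (simp add: algebra_simps)
  finally have cm: "(c + 1) * 2 ^ b \<le> m" .
  from Suc.IH[OF this] obtain u
    where u: "u div 2 ^ b = c" "take_bit b (u XOR h u) = take_bit b t" by blast
  have "u div 2 ^ Suc b = c div 2"
    by (simp only: div_power_Suc_two u(1))
  then have ua: "u div 2 ^ Suc b = a" by (simp add: c_def)
  have "u < (c + 1) * 2 ^ b"
    using dividend_less_times_div[of "2 ^ b" u] u(1) by (simp add: algebra_simps)
  then have "u < m" using cm by simp
  moreover have "a * 2 ^ Suc b < m"
    by (rule less_le_trans[OF _ Suc.prems]) simp
  ultimately have "h u div 2 ^ b = h (a * 2 ^ Suc b) div 2 ^ b"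
    by (rule NS_belowD[OF assms(1)]) (simp add: ua del: power_Suc)
  then have "bit (h u) b = bit (h (a * 2 ^ Suc b)) b" by (simp add: bit_iff_odd)
  moreover have "bit u b \<longleftrightarrow> bit (h (a * 2 ^ Suc b)) b \<noteq> bit t b"
    using u(1) by (simp add: bit_iff_odd[of u] c_def)
  ultimately have "bit (u XOR h u) b = bit t b" by (auto simp: bit_xor_iff)
  moreover have "bit (u XOR h u) n = bit t n" if "n < b" for n
    using arg_cong[OF u(2), of "\<lambda>x. bit x n"] that
    by (simp add: bit_take_bit_iff del: take_bit_xor)
  ultimately have "take_bit (Suc b) (u XOR h u) = take_bit (Suc b) t"
    by (intro bit_eqI) (auto simp: bit_take_bit_iff less_Suc_eq simp del: take_bit_xor)
  with ua show ?case by blast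
qed

lemma power_two_times_odd:
  fixes n :: nat
  assumes "0 < n"
  obtains r q where "n = 2 ^ r * q" "odd q"
proof -
  have "\<exists>r q. n = 2 ^ r * q \<and> odd q" using assms
  proof (induction n rule: less_induct)
    case (less n)
    show ?case
    proof (cases "even n")
      case True
      then obtain k where k: "n = 2 * k" by blast
      with less.prems less.IH[of k] obtain r q where "k = 2 ^ r * q" "odd q" by auto
      with k have "n = 2 ^ Suc r * q" by simp
      with \<open>odd q\<close> show ?thesis by blast
    next
      case False
      then have "n = 2 ^ 0 * n" by simp
      with False show ?thesis by blast
    qed
  qed
  then show thesis using that by blast
qed

lemma NS_below_step:
  fixes h :: "nat \<Rightarrow> nat"
  assumes mono: "mono h"
    and neq: "\<And>u v y. u < v \<Longrightarrow> h u < y \<Longrightarrow> y \<le> h v \<Longrightarrow> v \<noteq> u XOR h u XOR y"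
    and NS: "NS_below (Suc n) h"
    and n: "n div 2 ^ Suc j = Suc n div 2 ^ Suc j"
  shows "h n div 2 ^ j = h (Suc n) div 2 ^ j"
proof (rule ccontr)
  assume ne: "h n div 2 ^ j \<noteq> h (Suc n) div 2 ^ j"
  define k where "k = h n div 2 ^ j"
  \<comment> \<open>The least multiple of \<open>2 ^ j\<close> above \<open>h n\<close>; being
    least, it is within \<open>2 ^ j\<close> of \<open>h n\<close>.\<close>
  define Y where "Y = (k + 1) * 2 ^ j"
  have "h n \<le> h (Suc n)" using mono by (simp add: mono_def)
  then have "k \<le> h (Suc n) div 2 ^ j" unfolding k_def by (rule div_le_mono)
  with ne have "k + 1 \<le> h (Suc n) div 2 ^ j" by (simp add: k_def)
  then have "Y \<le> h (Suc n) div 2 ^ j * 2 ^ j" unfolding Y_def by (rule mult_le_mono1)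
  then have Yle: "Y \<le> h (Suc n)" using div_times_less_eq_dividend order_trans by blast
  have Yge: "h n < Y" "Y \<le> h n + 2 ^ j"
    using dividend_less_times_div[of "2 ^ j" "h n"] div_times_less_eq_dividend[of "h n" "2 ^ j"]
    by (simp_all add: Y_def k_def algebra_simps)
  obtain r q where r: "k + 1 = 2 ^ r * q" "odd q"
    by (rule power_two_times_odd[of "k + 1"]) auto
  define b where "b = r + j"
  have Yq: "Y = q * 2 ^ b" by (simp only: Y_def r b_def power_add mult_ac)
  have "(2::nat) ^ j \<le> 2 ^ b" by (simp add: b_def)
  obtain c where c: "q = Suc (2 * c)" using \<open>odd q\<close> oddE by fastforce
  \<comment> \<open>\<open>Y\<close> is an odd multiple of \<open>2 ^ b\<close> and exceeds
    \<open>h n\<close> by at most \<open>2 ^ b\<close>, so \<open>h n\<close> lies in the block just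
    before \<open>Y\<close>.\<close>
  have hn: "h n div 2 ^ b = 2 * c"
  proof (rule div_nat_eqI)
    have "Y = 2 * c * 2 ^ b + 2 ^ b" by (simp add: Yq c)
    with Yge \<open>2 ^ j \<le> 2 ^ b\<close> show "2 ^ b * (2 * c) \<le> h n" "h n < 2 ^ b * Suc (2 * c)"
      by (simp_all only: mult.commute[of "2 ^ b"] mult_Suc_right)
  qed
  have same: "n div 2 ^ Suc b = Suc n div 2 ^ Suc b"
    using arg_cong[OF n, of "\<lambda>x. x div 2 ^ r"]
    by (simp only: b_def div_exp_eq add.commute[of r] flip: add_Suc)
  \<comment> \<open>From bit \<open>b\<close> upwards, \<open>h u\<close> and \<open>Y\<close>
    differ in bit \<open>b\<close> alone, so there the XOR flips just that bit of
    \<open>u\<close>.\<close>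
  have high: "(u XOR h u XOR Y) div 2 ^ b = (u div 2 ^ b) XOR 1" if "h u div 2 ^ b = 2 * c" for u
  proof -
    have "Suc (2 * c) = (2 * c) XOR 1" by (simp add: xor_Suc_0_eq)
    then have "(2 * c) XOR Suc (2 * c) = 1" by (simp flip: xor.assoc)
    moreover have "Y div 2 ^ b = Suc (2 * c)" by (simp add: Yq c)
    ultimately show ?thesis
      using that by (simp flip: drop_bit_eq_div add: drop_bit_xor)
  qed
  \<comment> \<open>Otherwise monotonicity gives \<open>h u < Y \<le> h ?v\<close>, contrary to
    \<open>neq\<close>.\<close>
  have no: "u XOR h u XOR Y \<le> n" if "u \<le> n" for u
  proof (rule ccontr)
    let ?v = "u XOR h u XOR Y"
    assume "\<not> ?v \<le> n"
    then have "u < ?v" "h (Suc n) \<le> h ?v" using that mono by (auto simp: mono_def)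
    moreover have "h u < Y" using that mono Yge by (meson monoD le_less_trans)
    ultimately show False using neq[of u ?v Y] Yle by simp
  qed
  show False
  proof (cases "even (Suc n div 2 ^ b)")
    case True
    \<comment> \<open>An even quotient is the lower of its pair, so \<open>n\<close> shares it;
      flipping bit \<open>b\<close> then raises \<open>n\<close>.\<close>
    have "x = y" if "even y" "x \<le> y" "x div 2 = y div 2" for x y :: nat
      using that by presburger
    moreover note True
    moreover have "n div 2 ^ b \<le> Suc n div 2 ^ b" by (rule div_le_mono) simp
    moreover have "n div 2 ^ b div 2 = Suc n div 2 ^ b div 2"
      using same by (simp only: div_power_Suc_two)
    ultimately have "n div 2 ^ b = Suc n div 2 ^ b" by blast
    with True have "(n XOR h n XOR Y) div 2 ^ b = Suc (n div 2 ^ b)"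
      using high[OF hn] by (simp add: xor_Suc_0_eq)
    with no[of n] show False by (metis div_le_mono le_refl not_less_eq_eq)
  next
    case False
    then obtain a where a: "Suc n div 2 ^ b = Suc (2 * a)" using oddE by fastforce
    \<comment> \<open>Block \<open>2 * a\<close> of length \<open>2 ^ b\<close> lies wholly below
      \<open>Suc n\<close>, where \<open>NS\<close> applies.\<close>
    have "(2 * a + 1) * 2 ^ b \<le> Suc n"
      using a by (metis Suc_eq_plus1 div_times_less_eq_dividend)
    from NS_below_xor_onto[OF NS this] obtain u
      where u: "u div 2 ^ b = 2 * a" "take_bit b (u XOR h u) = take_bit b (Suc n)" by blast
    have "u < Suc n" using u(1) a by (metis div_le_mono lessI not_le)
    moreover have "u div 2 ^ Suc b = Suc n div 2 ^ Suc b"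
      by (simp add: div_power_Suc_two u(1) a del: power_Suc)
    ultimately have "h u div 2 ^ b = h n div 2 ^ b"
      by (intro NS_belowD[OF NS]) (simp_all only: same lessI)
    then have "h u div 2 ^ b = 2 * c" using hn by simp
    from high[OF this] have "drop_bit b (u XOR h u XOR Y) = drop_bit b (Suc n)"
      by (simp add: u(1) a xor_Suc_0_eq drop_bit_eq_div)
    moreover have "take_bit b (u XOR h u XOR Y) = take_bit b (Suc n)"
    proof -
      have "take_bit b Y = 0" by (simp add: Yq take_bit_eq_mod)
      with u(2) show ?thesis by (simp add: take_bit_xor)
    qed
    ultimately have "u XOR h u XOR Y = Suc n" by (metis bits_ident)
    with no[of u] \<open>u < Suc n\<close> show False by simp
  qed
qed

lemma NS_below_all:
  fixes h :: "nat \<Rightarrow> nat"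
  assumes "mono h"
    and "\<And>u v y. u < v \<Longrightarrow> h u < y \<Longrightarrow> y \<le> h v \<Longrightarrow> v \<noteq> u XOR h u XOR y"
  shows "NS_below m h"
proof (induction m)
  case 0
  show ?case by (simp add: NS_below_def)
next
  case (Suc m)
  have last: "h z div 2 ^ j = h m div 2 ^ j" if z: "z < m" "z div 2 ^ Suc j = m div 2 ^ Suc j" for z j
  proof -
    obtain n where m: "m = Suc n" using z(1) by (cases m) auto
    \<comment> \<open>As \<open>n\<close> lies between \<open>z\<close> and \<open>m\<close>, it
      shares their quotient; only the neighbours \<open>n\<close> and \<open>m\<close> remain to be
      compared.\<close>
    have "z div 2 ^ Suc j \<le> n div 2 ^ Suc j" "n div 2 ^ Suc j \<le> m div 2 ^ Suc j"
      using z(1) m by (auto intro!: div_le_mono)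
    with z(2) have n: "z div 2 ^ Suc j = n div 2 ^ Suc j" "n div 2 ^ Suc j = Suc n div 2 ^ Suc j"
      by (simp_all only: m)
    have "h z div 2 ^ j = h n div 2 ^ j"
      using Suc.IH z(1) _ n(1) by (rule NS_belowD) (simp add: m)
    with NS_below_step[OF assms Suc.IH[unfolded m] n(2)] show ?thesis by (simp add: m)
  qed
  show ?case
    unfolding NS_below_def less_Suc_eq using last NS_belowD[OF Suc.IH] by metis
qed

theorem theorem6:
  fixes s :: nat and F :: "nat list \<Rightarrow> nat"
  assumes "0 < s"
    and "monotonically_increasing s F"
    and "\<And>xs y. length xs = s \<Longrightarrow> y \<le> F xs \<Longrightarrow> grundy F (xs, y) = nim_sum (xs @ [y])"
  shows "\<forall>i<s. \<forall>xs. length xs = s \<longrightarrow> NS_property (section_fun F xs i)"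
proof (intro allI impI)
  fix i and xs :: "nat list"
  assume i: "i < s" and xs: "length xs = s"
  let ?h = "section_fun F xs i"
  have mono: "mono ?h" using assms(2) xs by (rule mono_section_fun)
  have NS: "NS_below m ?h" for m
    using mono section_fun_neq[OF assms(3) xs i] by (rule NS_below_all)
  have "?h z div 2 ^ (j - 1) = ?h z' div 2 ^ (j - 1)"
    if "1 \<le> j" "z div 2 ^ j = z' div 2 ^ j" for z z' j
    \<comment> \<open>The bound exceeds both arguments, and \<open>1 \<le> j\<close> turns
      \<open>Suc (j - 1)\<close> into \<open>j\<close>.\<close>
    by (rule NS_belowD[OF NS[of "Suc (max z z')"]])
      (use that in \<open>simp_all add: less_Suc_eq_le del: power_Suc\<close>)
  with mono show "NS_property ?h" unfolding NS_property_def by blast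
qed

end
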